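(* For every integer $n\ge 0$, $sp(2n+1)\equiv 2n+1 \pmod 4$.
   Context: $sp(n)$ is defined by $sp(0)=sp(1)=1$ and, for $n>1$, $sp(n)=sp(n/2)$ if $n$ is even and $sp(n)=2sp(n-1)+sp(n-2)$ if $n$ is odd. (It counts semi-Pell compositions of $n$.) *)

theory Defs
  imports "HOL-Number_Theory.Cong"
begin

fun sp :: "nat \<Rightarrow> nat" where
  "sp n =
    (if n \<le> 1 then 1
     else if even n then sp (n div 2)
     else 2 * sp (n - 1) + sp (n - 2))"

declare sp.simps [simp del]

end

theory Submission
  imports Defs
begin

text \<open>Oddness (\<open>odd_sp\<close>) persists because the recurrence either copies an earlier
  value or adds an even number to one. Twice an odd value is 2 modulo 4, so by
  \<open>sp_odd_rec\<close> both \<open>sp (2 * n + 1)\<close> and \<open>2 * n + 1\<close> grow by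
  2 modulo 4 when \<open>n\<close> grows by 1.\<close>

text \<open>Every value of \<open>sp\<close> is odd, so \<open>2 * sp (2 * n + 2)\<close> is congruent to 2 modulo 4,
  and passing from one odd argument to the next adds 2 modulo 4.\<close>

lemma odd_sp: "odd (sp n)"
proof (induction n rule: less_induct)
  case (less n)
  show ?case
  proof (cases "n \<le> 1")
    case True
    then show ?thesis by (simp add: sp.simps)
  next
    case False
    then show ?thesis
      using less.IH[of "n div 2"] less.IH[of "n - 2"] by (subst sp.simps) simp
  qed
qed

lemma sp_odd_rec: "sp (2 * n + 3) = 2 * sp (2 * n + 2) + sp (2 * n + 1)"
  by (subst sp.simps) simp

theorem theorem1p4:
  fixes n :: nat
  shows "[sp (2 * n + 1) = 2 * n + 1] (mod 4)"
proof (induction n)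
  case 0
  show ?case by (simp add: sp.simps)
next
  case (Suc n)
  obtain k where "sp (2 * n + 2) = 2 * k + 1"
    using odd_sp by (rule oddE)
  \<comment> \<open>Doubling \<open>2 * k + 1\<close> gives \<open>4 * k + 2\<close>.\<close>
  then have "[2 * sp (2 * n + 2) = 2] (mod 4)"
    by (simp add: cong_def) presburger
  then have "[sp (2 * n + 3) = 2 + (2 * n + 1)] (mod 4)"
    unfolding sp_odd_rec using Suc.IH by (rule cong_add)
  \<comment> \<open>Unary numerals identify \<open>2 * Suc n + 1\<close> with
    \<open>2 * n + 3\<close>.\<close>
  then show ?case by (simp add: numeral_eq_Suc)
qed

end
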